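(* Let $R_n(\pi/2)$ be the strict hyperbolic kissing number of hyperbolic $n$-space for the angle $\pi/2$, and let $\phi_0=\arccos(3/4)$. Then $R_0(\pi/2)=0$ and $R_1(\pi/2)=1$. For every $n\ge 2$, $$\left\lfloor \frac{K_{n-1}(2\phi_0)}{2}\right\rfloor \;\le\; R_n(\pi/2)\;\le\; K_{n-1}(\phi_0)+2,$$ where $K_{n-1}(\phi)$ is the classical kissing number for the Euclidean unit sphere $\mathbb{S}^{n-2}\subset\mathbb{R}^{n-1}$ associated with the angle $\phi$.
   Context: Spherical codes. For $x,y$ in the unit sphere $\mathbb{S}^{d-1}\subset\mathbb{R}^d$, let $\phi(x,y)\in[0,\pi]$ be the angle with $\cos\phi(x,y)=x\cdot y$. For $0<\phi\le\pi$, $K_d(\phi)$ is the maximal cardinality of a subset $\mathcal{S}\subset\mathbb{S}^{d-1}$ such that $\phi(x,y)\ge\phi$ for all distinct $x,y\in\mathcal{S}$. Hyperbolic codes. Write elements of $\mathbb{R}^n\perp\mathbb{R}$ as $(v;u)$ with $v\in\mathbb{R}^n$, $u\in\mathbb{R}$, and set $I((v;u),(v';u'))=-\langle v,v'\rangle+uu'$, where $\langle\ ,\ \rangle$ is the Euclidean inner product. The hyperboloid model of hyperbolic $n$-space is $L^n=\{q=(v;u): I(q,q)=1,\ u>0\}$. Projection from $(\underline{0};-1)$, $\pi(v;u)=v/(1+u)$, identifies $L^n$ with the open unit ball $B^n\subset\mathbb{R}^n$, with ideal boundary $\mathbb{S}^{n-1}$. A vector $w\in\mathbb{R}^n\perp\mathbb{R}$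 is negative if $I(w,w)<0$. For such $w$ set $Y(w)=\{\pi(q): q\in L^n,\ I(w,q)\le 0\}$ (a closed geodesic half-space) and $W(w)=\{\pi(q): q\in L^n,\ I(w,q)=0\}$ (its boundary), and let $\overline{Y}(w)$, $\overline{W}(w)$ be obtained by adjoining the ideal boundary points in $\mathbb{S}^{n-1}$. For negative $w_1,w_2$: if $\overline{W}(w_1)\cap\overline{W}(w_2)\neq\emptyset$, then $\theta(w_1,w_2)\in[0,\pi]$ is the angle between the outward unit normals to $Y(w_1)$ and $Y(w_2)$ at a common point, given by $\cos\theta(w_1,w_2)=-I(w_1,w_2)/\sqrt{I(w_1,w_1)I(w_2,w_2)}$; if $\overline{W}(w_1)\cap\overline{W}(w_2)=\emptyset$, then $\theta(w_1,w_2)=-\infty$. A hyperbolic code is a set $\mathcal{S}$ of negative vectors of $\mathbb{R}^n\perp\mathbb{R}$; it is strict if $\bigcup_{w\in\mathcal{S}}Y(w)\ne B^n$. Its angle $\theta(\mathcal{S})$ is the greatest lower bound in $\{-\infty\}\cup[0,\pi]$ of $\theta(w_1,w_2)$ over distinct $w_1,w_2\in\mathcal{S}$. For $0<\theta\le\pi$, the strict hyperbolic kissing number $R_n(\theta)\in\mathbb{Z}\cup\{\infty\}$ is the supremum of $\#\mathcal{S}$ over strict hyperbolic codes $\mathcal{S}\subset\mathbb{R}^n\perp\mathbb{R}$ with $\theta(\mathcal{S})\ge\theta$. *)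

theory Defs
  imports "HOL-Analysis.Analysis" "HOL-Library.Extended_Nat"
begin

text \<open>
  The dimension varies inside the statements to be made, so \<open>\<real>\<^sup>d\<close> is the
  topological space \<^term>\<open>Euclidean_space d\<close>, whose points are the sequences
  \<open>x :: nat \<Rightarrow> real\<close> with \<open>x i = 0\<close> for \<open>i \<ge> d\<close>.
\<close>

definition eucl_inner :: "nat \<Rightarrow> (nat \<Rightarrow> real) \<Rightarrow> (nat \<Rightarrow> real) \<Rightarrow> real" where
  "eucl_inner d x y = (\<Sum>i<d. x i * y i)"


subsection \<open>Spherical codes\<close>

definition unit_sphere :: "nat \<Rightarrow> (nat \<Rightarrow> real) set" where
  "unit_sphere d = {x \<in> topspace (Euclidean_space d). eucl_inner d x x = 1}"

definition sph_angle :: "nat \<Rightarrow> (nat \<Rightarrow> real) \<Rightarrow> (nat \<Rightarrow> real) \<Rightarrow> real" where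
  "sph_angle d x y = arccos (eucl_inner d x y)"

definition spherical_code :: "nat \<Rightarrow> real \<Rightarrow> (nat \<Rightarrow> real) set \<Rightarrow> bool" where
  "spherical_code d \<phi> S \<longleftrightarrow>
     S \<subseteq> unit_sphere d \<and> (\<forall>x\<in>S. \<forall>y\<in>S. x \<noteq> y \<longrightarrow> sph_angle d x y \<ge> \<phi>)"

text \<open>
  For \<open>0 < \<phi> \<le> \<pi>\<close> the maximum below is genuine: all codes are finite and their
  cardinalities are bounded, see \<open>spherical_kissing_attained\<close> and
  \<open>spherical_kissing_upper\<close>.
\<close>

definition spherical_kissing :: "nat \<Rightarrow> real \<Rightarrow> nat" where
  "spherical_kissing d \<phi> = Max (card ` {S. spherical_code d \<phi> S})"


subsection \<open>Hyperbolic codes\<close>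

text \<open>An element \<open>(v;u)\<close> of \<open>\<real>\<^sup>n \<bottom> \<real>\<close> is the pair \<open>(v, u)\<close>.\<close>

definition lorentz_space :: "nat \<Rightarrow> ((nat \<Rightarrow> real) \<times> real) set" where
  "lorentz_space n = topspace (Euclidean_space n) \<times> UNIV"

definition lorentz_form ::
    "nat \<Rightarrow> (nat \<Rightarrow> real) \<times> real \<Rightarrow> (nat \<Rightarrow> real) \<times> real \<Rightarrow> real" where
  "lorentz_form n p q = - eucl_inner n (fst p) (fst q) + snd p * snd q"

definition hyperboloid :: "nat \<Rightarrow> ((nat \<Rightarrow> real) \<times> real) set" where
  "hyperboloid n = {q \<in> lorentz_space n. lorentz_form n q q = 1 \<and> snd q > 0}"

definition ball_proj :: "(nat \<Rightarrow> real) \<times> real \<Rightarrow> (nat \<Rightarrow> real)" where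
  "ball_proj q = (\<lambda>i. fst q i / (1 + snd q))"

definition unit_ball :: "nat \<Rightarrow> (nat \<Rightarrow> real) set" where
  "unit_ball n = {x \<in> topspace (Euclidean_space n). eucl_inner n x x < 1}"

definition negative_vectors :: "nat \<Rightarrow> ((nat \<Rightarrow> real) \<times> real) set" where
  "negative_vectors n = {w \<in> lorentz_space n. lorentz_form n w w < 0}"

definition half_space :: "nat \<Rightarrow> (nat \<Rightarrow> real) \<times> real \<Rightarrow> (nat \<Rightarrow> real) set" where
  "half_space n w = ball_proj ` {q \<in> hyperboloid n. lorentz_form n w q \<le> 0}"

definition wall :: "nat \<Rightarrow> (nat \<Rightarrow> real) \<times> real \<Rightarrow> (nat \<Rightarrow> real) set" where
  "wall n w = ball_proj ` {q \<in> hyperboloid n. lorentz_form n w q = 0}"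

text \<open>
  The wall is closed in the open unit ball, so its closure in \<open>\<real>\<^sup>n\<close> adjoins exactly
  its ideal boundary points on the unit sphere.
\<close>

definition closed_wall :: "nat \<Rightarrow> (nat \<Rightarrow> real) \<times> real \<Rightarrow> (nat \<Rightarrow> real) set" where
  "closed_wall n w = Euclidean_space n closure_of wall n w"

text \<open>
  When the closed walls meet, the quotient below is the inner product of the outward
  unit normals at a common point, and lies in \<open>[-1, 1]\<close>.
\<close>

definition hyp_angle ::
    "nat \<Rightarrow> (nat \<Rightarrow> real) \<times> real \<Rightarrow> (nat \<Rightarrow> real) \<times> real \<Rightarrow> ereal" where
  "hyp_angle n w1 w2 =
     (if closed_wall n w1 \<inter> closed_wall n w2 \<noteq> {}
      then ereal (arccos (- lorentz_form n w1 w2 /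
                          sqrt (lorentz_form n w1 w1 * lorentz_form n w2 w2)))
      else - \<infinity>)"

definition hyperbolic_code :: "nat \<Rightarrow> ((nat \<Rightarrow> real) \<times> real) set \<Rightarrow> bool" where
  "hyperbolic_code n S \<longleftrightarrow> S \<subseteq> negative_vectors n"

definition strict_code :: "nat \<Rightarrow> ((nat \<Rightarrow> real) \<times> real) set \<Rightarrow> bool" where
  "strict_code n S \<longleftrightarrow> hyperbolic_code n S \<and> (\<Union>w\<in>S. half_space n w) \<noteq> unit_ball n"

text \<open>
  Inserting \<open>\<pi>\<close> makes the infimum in \<^typ>\<open>ereal\<close> the greatest lower bound in
  \<open>{-\<infinity>} \<union> [0, \<pi>]\<close>: it only matters when \<open>S\<close> has fewer than two elements, where the
  greatest lower bound of the empty set is \<open>\<pi>\<close>.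
\<close>

definition code_angle :: "nat \<Rightarrow> ((nat \<Rightarrow> real) \<times> real) set \<Rightarrow> ereal" where
  "code_angle n S =
     Inf (insert (ereal pi) {hyp_angle n w1 w2 | w1 w2. w1 \<in> S \<and> w2 \<in> S \<and> w1 \<noteq> w2})"

definition ecard :: "'a set \<Rightarrow> enat" where
  "ecard A = (if finite A then enat (card A) else \<infinity>)"

definition strict_hyp_kissing :: "nat \<Rightarrow> real \<Rightarrow> enat" where
  "strict_hyp_kissing n \<theta> = (SUP S \<in> {S. strict_code n S \<and> code_angle n S \<ge> ereal \<theta>}. ecard S)"


subsection \<open>The maximum defining the spherical kissing number exists\<close>

lemma spherical_codes_bounded:
  assumes "0 < \<phi>" "\<phi> \<le> pi"
  obtains B where "\<And>S. spherical_code d \<phi> S \<Longrightarrow> finite S \<and> card S \<le> B"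
proof -
  have c: "cos \<phi> < 1"
    using cos_monotone_0_pi[of 0 \<phi>] assms by simp
  obtain N :: nat where N: "real N > (real d + 1) / (1 - cos \<phi>)"
    using reals_Archimedean2 by blast
  have Npos: "real N > 0"
    using N c by (smt (verit) divide_nonneg_pos of_nat_0_le_iff)
  define g where "g x = (\<lambda>i\<in>{..<d}. \<lfloor>x i * real N\<rfloor>)" for x :: "nat \<Rightarrow> real"
  define T where "T = ({..<d} \<rightarrow>\<^sub>E {- int N..int N})"
  have finT: "finite T"
    unfolding T_def by (intro finite_PiE) auto
  have coord: "\<bar>x i\<bar> \<le> 1" if "x \<in> unit_sphere d" "i < d" for x i
  proof -
    have "x i * x i \<le> (\<Sum>i<d. x i * x i)"
      using that(2) by (intro member_le_sum) auto
    also have "\<dots> = 1"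
      using that(1) by (simp add: unit_sphere_def eucl_inner_def)
    finally show ?thesis
      by (metis abs_square_le_1 power2_eq_square)
  qed
  have "finite S \<and> card S \<le> card T" if S: "spherical_code d \<phi> S" for S
  proof -
    have sub: "S \<subseteq> unit_sphere d"
      using S by (simp add: spherical_code_def)
    have im: "g ` S \<subseteq> T"
    proof -
      have "\<lfloor>x i * real N\<rfloor> \<in> {- int N..int N}" if "x \<in> S" "i < d" for x i
      proof -
        have "\<bar>x i * real N\<bar> \<le> 1 * real N"
          unfolding abs_mult using coord that sub Npos by (intro mult_mono) auto
        then have "- real N \<le> x i * real N" "x i * real N \<le> real N"
          by linarith+
        then show ?thesis
          by (simp add: le_floor_iff) (smt (verit) floor_mono floor_of_nat)
      qed
      then show ?thesis
        by (auto simp: g_def T_def PiE_iff split: if_splits)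
    qed
    have inj: "inj_on g S"
    proof (rule inj_onI, rule ccontr)
      fix x y assume xy: "x \<in> S" "y \<in> S" "g x = g y" "x \<noteq> y"
      have close: "\<bar>x i - y i\<bar> \<le> 1 / real N" if "i < d" for i
      proof -
        have "\<lfloor>x i * real N\<rfloor> = \<lfloor>y i * real N\<rfloor>"
          using fun_cong[OF xy(3), of i] that by (simp add: g_def)
        then have "\<bar>x i * real N - y i * real N\<bar> \<le> 1"
          by linarith
        then have "\<bar>x i - y i\<bar> * real N \<le> 1"
          using Npos by (metis abs_mult abs_of_pos left_diff_distrib)
        then show ?thesis
          using Npos by (simp add: field_simps)
      qed
      have one: "eucl_inner d x x = 1" "eucl_inner d y y = 1"
        using xy sub by (auto simp: unit_sphere_def)
      have "2 - 2 * eucl_inner d x y = (\<Sum>i<d. (x i - y i)\<^sup>2)"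
      proof -
        have "(\<Sum>i<d. (x i - y i)\<^sup>2)
            = eucl_inner d x x + eucl_inner d y y - 2 * eucl_inner d x y"
          by (simp add: eucl_inner_def sum_distrib_left sum.distrib[symmetric]
              sum_subtractf[symmetric] power2_eq_square algebra_simps)
        then show ?thesis using one by simp
      qed
      also have "\<dots> \<le> (\<Sum>i<d. 2 * (1 / real N))"
      proof (rule sum_mono)
        fix i assume "i \<in> {..<d}"
        then have i: "i < d" by simp
        have "\<bar>x i - y i\<bar> \<le> 2"
          using coord[of x i] coord[of y i] xy sub i by fastforce
        then have "\<bar>x i - y i\<bar> * \<bar>x i - y i\<bar> \<le> 2 * (1 / real N)"
          using close[OF i] by (intro mult_mono) auto
        then show "(x i - y i)\<^sup>2 \<le> 2 * (1 / real N)"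
          by (simp add: power2_eq_square)
      qed
      also have "\<dots> = 2 * (real d / real N)"
        by simp
      finally have up: "1 - eucl_inner d x y \<le> real d / real N"
        by linarith
      have "real d / real N < 1 - cos \<phi>"
        using N c Npos by (simp add: field_simps)
      then have gt: "cos \<phi> < eucl_inner d x y"
        using up by linarith
      have le1: "eucl_inner d x y \<le> 1"
      proof -
        have "2 * eucl_inner d x y \<le> eucl_inner d x x + eucl_inner d y y"
          unfolding eucl_inner_def sum_distrib_left sum.distrib[symmetric]
          using sum_squares_bound by (intro sum_mono) (simp add: power2_eq_square mult.assoc)
        then show ?thesis using one by simp
      qed
      have "arccos (eucl_inner d x y) < arccos (cos \<phi>)"
        using gt le1 by (intro arccos_less_arccos) auto
      also have "\<dots> = \<phi>"
        using assms by (simp add: arccos_cos)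
      finally show False
        using S xy(1,2,4) unfolding spherical_code_def sph_angle_def by (meson not_less)
    qed
    show ?thesis
      using im inj finT by (meson card_inj_on_le inj_on_finite)
  qed
  then show thesis
    using that by blast
qed

lemma spherical_code_finite:
  assumes "0 < \<phi>" "\<phi> \<le> pi" "spherical_code d \<phi> S"
  shows "finite S"
  using spherical_codes_bounded[OF assms(1,2), where d = d] assms(3) by metis

lemma finite_spherical_code_cards:
  assumes "0 < \<phi>" "\<phi> \<le> pi"
  shows "finite (card ` {S. spherical_code d \<phi> S})"
proof -
  obtain B where "\<And>S. spherical_code d \<phi> S \<Longrightarrow> finite S \<and> card S \<le> B"
    using spherical_codes_bounded[OF assms, where d = d] by metis
  then have "card ` {S. spherical_code d \<phi> S} \<subseteq> {..B}"
    by auto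
  then show ?thesis
    using finite_subset by blast
qed

lemma spherical_kissing_upper:
  assumes "0 < \<phi>" "\<phi> \<le> pi" "spherical_code d \<phi> S"
  shows "card S \<le> spherical_kissing d \<phi>"
  unfolding spherical_kissing_def
  using finite_spherical_code_cards[OF assms(1,2)] assms(3) by (intro Max_ge) auto

lemma spherical_kissing_attained:
  assumes "0 < \<phi>" "\<phi> \<le> pi"
  obtains S where "spherical_code d \<phi> S" "finite S" "card S = spherical_kissing d \<phi>"
proof -
  have "spherical_code d \<phi> {}"
    by (simp add: spherical_code_def)
  then have "spherical_kissing d \<phi> \<in> card ` {S. spherical_code d \<phi> S}"
    unfolding spherical_kissing_def
    using finite_spherical_code_cards[OF assms] by (intro Max_in) auto
  then show thesis
    using that spherical_code_finite[OF assms] by (metis (mono_tags) imageE mem_Collect_eq)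
qed

end

theory Submission
  imports Defs
begin

text \<open>
  For negative vectors whose closed walls meet, the angle is at least \<open>\<pi>/2\<close> exactly when the
  Lorentz form of the two vectors is nonnegative, and meeting walls satisfy the Cauchy-Schwarz
  inequality (\<open>right_angle_condition\<close>). In the upper half-space model this is elementary
  geometry of balls in \<open>\<real>\<^bsup>n-1\<^esup>\<close>: balls of radii \<open>r\<close>, \<open>s\<close> belong to a code of angle \<open>\<pi>/2\<close> if and
  only if the squared distance of their centres lies between \<open>r\<^sup>2 + s\<^sup>2\<close> and \<open>(r + s)\<^sup>2\<close>.

  For the upper bound, pick a point \<open>q\<close> left uncovered by a strict code and a member \<open>w\<close> of it, and
  let \<open>p\<close> be the centre of the cap of \<open>w\<close> seen from \<open>q\<close>. The angle condition forces all other
  members to avoid \<open>p\<close> (\<open>ideal_point_of_cap\<close>), so with \<open>p\<close> at infinity they become balls. The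
  smallest ball meets all the others, and comparing radii shows that their centres are seen from
  its centre at angles at least \<open>\<phi>\<^sub>0 = arccos (3/4)\<close> (\<open>kissing_cosine_bound\<close>); the extreme case is
  that of equal balls touching the central one. Hence at most \<open>K\<^bsub>n-1\<^esub>(\<phi>\<^sub>0)\<close> members remain besides \<open>w\<close>
  and the smallest ball.

  For the lower bound, use balls of the same radius around points of a spherical code of angle
  \<open>2\<phi>\<^sub>0\<close>. Their centres are far enough apart, but may be too far apart if the points are nearly
  antipodal. Each point has at most one such bad partner (\<open>near_antipodes_close\<close>), so discarding at
  most half of the points removes all bad pairs.

  There are no negative vectors for \<open>n = 0\<close>, and for \<open>n = 1\<close> walls are points, so that the walls
  of two members would have to coincide.
\<close>

section \<open>Linear algebra of the Lorentz form\<close>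

lemma eucl_inner_commute: "eucl_inner d x y = eucl_inner d y x"
  by (simp add: eucl_inner_def mult.commute)

lemma eucl_inner_combination_left:
  "eucl_inner d (\<lambda>i. a * x i + b * y i) z = a * eucl_inner d x z + b * eucl_inner d y z"
  by (simp add: eucl_inner_def algebra_simps sum.distrib sum_distrib_left)

lemma eucl_inner_nonneg: "eucl_inner d x x \<ge> 0"
  by (simp add: eucl_inner_def sum_nonneg)

lemma eucl_inner_Cauchy_Schwarz:
  "(eucl_inner d x y)\<^sup>2 \<le> eucl_inner d x x * eucl_inner d y y"
  using Cauchy_Schwarz_ineq_sum[of x y "{..<d}"]
  by (simp add: eucl_inner_def power2_eq_square)

lemma eucl_inner_scale:
  "eucl_inner d (\<lambda>i. a * x i) (\<lambda>i. b * y i) = a * b * eucl_inner d x y"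
  by (simp add: eucl_inner_def sum_distrib_left mult.assoc mult.left_commute)

text \<open>
  Vectors of \<open>\<real>\<^sup>n \<bottom> \<real>\<close> are plain pairs, so their linear combinations get a name of their
  own, and bilinearity of the form becomes rewriting with \<open>lorentz_form_lcomb\<close>.
\<close>

definition lcomb ::
    "real \<Rightarrow> (nat \<Rightarrow> real) \<times> real \<Rightarrow> real \<Rightarrow> (nat \<Rightarrow> real) \<times> real \<Rightarrow> (nat \<Rightarrow> real) \<times> real" where
  "lcomb a p b q = (\<lambda>i. a * fst p i + b * fst q i, a * snd p + b * snd q)"

lemma snd_lcomb: "snd (lcomb a p b q) = a * snd p + b * snd q"
  by (simp add: lcomb_def)

lemma lcomb_in_lorentz_space:
  "p \<in> lorentz_space n \<Longrightarrow> q \<in> lorentz_space n \<Longrightarrow> lcomb a p b q \<in> lorentz_space n"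
  by (auto simp: lorentz_space_def lcomb_def topspace_Euclidean_space)

lemma lorentz_form_commute: "lorentz_form n p q = lorentz_form n q p"
  by (simp add: lorentz_form_def eucl_inner_commute mult.commute)

lemma lorentz_form_lcomb_left:
  "lorentz_form n (lcomb a p b q) r = a * lorentz_form n p r + b * lorentz_form n q r"
  by (simp add: lorentz_form_def lcomb_def eucl_inner_combination_left algebra_simps)

lemma lorentz_form_lcomb_right:
  "lorentz_form n r (lcomb a p b q) = a * lorentz_form n r p + b * lorentz_form n r q"
  using lorentz_form_lcomb_left lorentz_form_commute by metis

lemmas lorentz_form_lcomb = lorentz_form_lcomb_left lorentz_form_lcomb_right

abbreviation origin :: "(nat \<Rightarrow> real) \<times> real" where
  "origin \<equiv> (\<lambda>i. 0, 1)"

lemma lorentz_form_origin [simp]: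
  "lorentz_form n origin w = snd w" "lorentz_form n w origin = snd w"
  by (simp_all add: lorentz_form_def eucl_inner_def)

lemma origin_in_lorentz_space [simp]: "origin \<in> lorentz_space n"
  by (simp add: lorentz_space_def topspace_Euclidean_space)

text \<open>
  The reason why hyperbolic walls that meet behave like Euclidean hyperplanes: on the
  orthogonal complement of a timelike vector the form is negative definite, and for a null
  vector it is still semidefinite, by the Euclidean Cauchy-Schwarz inequality.
\<close>

lemma lorentz_form_nonpos_on_orthogonal:
  assumes "lorentz_form n Q Q \<ge> 0" "snd Q > 0" "lorentz_form n w Q = 0"
  shows "lorentz_form n w w \<le> 0"
proof -
  have "(snd w)\<^sup>2 * (snd Q)\<^sup>2 = (eucl_inner n (fst w) (fst Q))\<^sup>2"
    using assms(3) by (simp add: lorentz_form_def power_mult_distrib[symmetric])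
  also have "\<dots> \<le> eucl_inner n (fst w) (fst w) * eucl_inner n (fst Q) (fst Q)"
    by (rule eucl_inner_Cauchy_Schwarz)
  also have "\<dots> \<le> eucl_inner n (fst w) (fst w) * (snd Q)\<^sup>2"
    using assms(1)
    by (intro mult_left_mono eucl_inner_nonneg) (simp add: lorentz_form_def power2_eq_square)
  finally show ?thesis
    using assms(2) by (simp add: lorentz_form_def power2_eq_square)
qed

lemma lorentz_Cauchy_Schwarz_on_orthogonal:
  assumes Q: "lorentz_form n Q Q \<ge> 0" "snd Q > 0"
    and w: "lorentz_form n w1 Q = 0" "lorentz_form n w2 Q = 0" "lorentz_form n w1 w1 < 0"
  shows "(lorentz_form n w1 w2)\<^sup>2 \<le> lorentz_form n w1 w1 * lorentz_form n w2 w2"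
proof -
  let ?a = "lorentz_form n w1 w1" and ?b = "lorentz_form n w1 w2" and ?c = "lorentz_form n w2 w2"
  let ?w = "lcomb ?b w1 (- ?a) w2"
  have "lorentz_form n ?w Q = 0"
    using w by (simp add: lorentz_form_lcomb)
  then have "lorentz_form n ?w ?w \<le> 0"
    by (rule lorentz_form_nonpos_on_orthogonal[OF Q])
  moreover have "lorentz_form n ?w ?w = ?a * (?a * ?c - ?b\<^sup>2)"
    using lorentz_form_commute[of n w2 w1]
    by (simp add: lorentz_form_lcomb power2_eq_square algebra_simps)
  ultimately show ?thesis
    using w(3) by (simp add: mult_le_0_iff)
qed

section \<open>Walls and the angle condition\<close>

lemma ball_proj_in_unit_ball:
  assumes "q \<in> hyperboloid n"
  shows "ball_proj q \<in> unit_ball n"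
proof -
  have q: "eucl_inner n (fst q) (fst q) = (snd q)\<^sup>2 - 1" "snd q > 0" "\<forall>i\<ge>n. fst q i = 0"
    using assms
    by (auto simp: hyperboloid_def lorentz_form_def lorentz_space_def topspace_Euclidean_space
        power2_eq_square)
  have "eucl_inner n (ball_proj q) (ball_proj q) = ((snd q)\<^sup>2 - 1) / (1 + snd q)\<^sup>2"
    using eucl_inner_scale[of n "1 / (1 + snd q)" "fst q" "1 / (1 + snd q)" "fst q"] q(1)
    by (simp add: ball_proj_def power2_eq_square)
  also have "\<dots> < 1"
    using q(2) by (subst divide_less_eq_1_pos) (simp_all add: power2_sum add_pos_nonneg)
  finally show ?thesis
    using q(3) by (simp add: unit_ball_def ball_proj_def topspace_Euclidean_space)
qed

text \<open>
  Inverse stereographic projection up to the positive factor \<open>1 - |x|\<^sup>2\<close>; leaving out the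
  denominator keeps it defined on the ideal boundary, where its values are null vectors.
\<close>

definition cone_lift :: "nat \<Rightarrow> (nat \<Rightarrow> real) \<Rightarrow> (nat \<Rightarrow> real) \<times> real" where
  "cone_lift n x = (\<lambda>i. 2 * x i, 1 + eucl_inner n x x)"

lemma lorentz_form_cone_lift:
  "lorentz_form n (cone_lift n x) (cone_lift n x) = (1 - eucl_inner n x x)\<^sup>2"
  unfolding lorentz_form_def cone_lift_def fst_conv snd_conv eucl_inner_scale
  by (simp add: power2_eq_square algebra_simps)

lemma snd_cone_lift_pos: "snd (cone_lift n x) > 0"
  using eucl_inner_nonneg[of n x] by (simp add: cone_lift_def)

lemma lorentz_form_cone_lift_ball_proj:
  assumes "q \<in> hyperboloid n"
  shows "lorentz_form n w (cone_lift n (ball_proj q)) = 2 / (1 + snd q) * lorentz_form n w q"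
proof -
  have q: "eucl_inner n (fst q) (fst q) = (snd q)\<^sup>2 - 1" "snd q > 0"
    using assms by (auto simp: hyperboloid_def lorentz_form_def power2_eq_square)
  have n: "eucl_inner n (ball_proj q) (ball_proj q) = ((snd q)\<^sup>2 - 1) / (1 + snd q)\<^sup>2"
    using eucl_inner_scale[of n "1 / (1 + snd q)" "fst q" "1 / (1 + snd q)" "fst q"] q(1)
    by (simp add: ball_proj_def power2_eq_square)
  have s: "1 + eucl_inner n (ball_proj q) (ball_proj q) = 2 / (1 + snd q) * snd q"
    unfolding n using q(2) by (simp add: power2_eq_square divide_simps) (simp add: algebra_simps)
  have f: "eucl_inner n (fst w) (\<lambda>i. 2 * ball_proj q i)
      = 2 / (1 + snd q) * eucl_inner n (fst w) (fst q)"
    using eucl_inner_scale[of n 1 "fst w" "2 / (1 + snd q)" "fst q"] by (simp add: ball_proj_def)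
  show ?thesis
    unfolding lorentz_form_def cone_lift_def fst_conv snd_conv s f by (simp add: algebra_simps)
qed

text \<open>
  The topology of \<^term>\<open>Euclidean_space n\<close> is that of a closed subspace of the function type
  \<^typ>\<open>nat \<Rightarrow> real\<close>, so closures can be computed with the type class topology.
\<close>

lemma continuous_on_eucl_inner [continuous_intros]:
  assumes "\<And>i. continuous_on A (\<lambda>x. f x i)" "\<And>i. continuous_on A (\<lambda>x. g x i)"
  shows "continuous_on A (\<lambda>x. eucl_inner n (f x) (g x))"
  unfolding eucl_inner_def by (intro continuous_intros assms)

lemma closed_wall_subset:
  "closed_wall n w \<subseteq> {x. eucl_inner n x x \<le> 1 \<and> lorentz_form n w (cone_lift n x) = 0}"
    (is "_ \<subseteq> ?C")
proof -
  let ?E = "topspace (Euclidean_space n)"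
  have "closed ?C"
    unfolding lorentz_form_def cone_lift_def fst_conv snd_conv
    by (intro closed_Collect_conj closed_Collect_le closed_Collect_eq continuous_intros
        continuous_on_product_coordinates)
  moreover have "closed ?E"
    using closedin_topspace[of "Euclidean_space n"] closedin_Euclidean_imp_closed by blast
  ultimately have "closedin (Euclidean_space n) (?C \<inter> ?E)"
    by (simp add: closedin_Euclidean_space_iff closed_Int)
  moreover have "wall n w \<subseteq> ?C \<inter> ?E"
  proof
    fix x assume "x \<in> wall n w"
    then obtain q where q: "q \<in> hyperboloid n" "lorentz_form n w q = 0" "x = ball_proj q"
      by (auto simp: wall_def)
    then show "x \<in> ?C \<inter> ?E"
      using ball_proj_in_unit_ball[OF q(1)] lorentz_form_cone_lift_ball_proj[OF q(1), of w]
      by (simp add: unit_ball_def)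
  qed
  ultimately show ?thesis
    unfolding closed_wall_def using closure_of_minimal by blast
qed

text \<open>
  A common point of the closed walls, lifted to the closed light cone, is orthogonal to both
  vectors, which gives the Cauchy-Schwarz inequality. It places the argument of \<^const>\<open>arccos\<close>
  in \<open>[-1, 1]\<close>, and only then does the bound on the angle yield the sign of the form.
\<close>

lemma right_angle_condition:
  assumes w: "w1 \<in> negative_vectors n" "w2 \<in> negative_vectors n"
    and angle: "hyp_angle n w1 w2 \<ge> ereal (pi / 2)"
  obtains x where "eucl_inner n x x \<le> 1"
    "lorentz_form n w1 (cone_lift n x) = 0" "lorentz_form n w2 (cone_lift n x) = 0"
    "lorentz_form n w1 w2 \<ge> 0"
    "(lorentz_form n w1 w2)\<^sup>2 \<le> lorentz_form n w1 w1 * lorentz_form n w2 w2"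
proof -
  let ?a = "lorentz_form n w1 w1" and ?b = "lorentz_form n w1 w2" and ?c = "lorentz_form n w2 w2"
  have neg: "?a < 0" "?c < 0"
    using w by (auto simp: negative_vectors_def)
  have meet: "closed_wall n w1 \<inter> closed_wall n w2 \<noteq> {}"
    using angle by (auto simp: hyp_angle_def split: if_splits)
  then obtain x where "x \<in> closed_wall n w1" "x \<in> closed_wall n w2"
    by blast
  then have x: "eucl_inner n x x \<le> 1"
    "lorentz_form n w1 (cone_lift n x) = 0" "lorentz_form n w2 (cone_lift n x) = 0"
    using closed_wall_subset by blast+
  have CS: "?b\<^sup>2 \<le> ?a * ?c"
    using lorentz_Cauchy_Schwarz_on_orthogonal[of n "cone_lift n x" w1 w2] x(2,3) neg(1)
    by (simp add: lorentz_form_cone_lift snd_cone_lift_pos)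
  have pos: "?a * ?c > 0"
    using neg by (simp add: mult_neg_neg)
  have b: "\<bar>?b / sqrt (?a * ?c)\<bar> \<le> 1"
    using CS pos real_sqrt_le_mono[OF CS] by (simp add: abs_divide)
  have "?b \<ge> 0"
  proof (rule ccontr)
    assume "\<not> ?b \<ge> 0"
    then have "0 < - ?b / sqrt (?a * ?c)"
      using pos by (intro divide_pos_pos) auto
    then have "arccos (- ?b / sqrt (?a * ?c)) < arccos 0"
      using b by (intro arccos_less_arccos) (simp_all only: abs_le_iff minus_divide_left)
    moreover have "arccos (- ?b / sqrt (?a * ?c)) \<ge> pi / 2"
      using angle meet by (simp add: hyp_angle_def)
    ultimately show False by simp
  qed
  then show thesis
    using that x CS by blast
qed

text \<open>
  Pushing \<open>Q\<close> slightly towards a point of the wall inside hyperbolic space moves it into the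
  open cone, so the central projections of the perturbed vectors are points of the wall that
  converge to the projection of \<open>Q\<close>. This is what supplies the ideal points of a wall.
\<close>

lemma projection_in_closed_wall:
  assumes Q: "Q \<in> lorentz_space n" "lorentz_form n Q Q \<ge> 0" "snd Q > 0"
    and w: "w \<in> negative_vectors n" "lorentz_form n w Q = 0"
  shows "(\<lambda>i. fst Q i / (sqrt (lorentz_form n Q Q) + snd Q)) \<in> closed_wall n w"
proof -
  define m where "m = - lorentz_form n w w"
  have m: "m > 0" and wsp: "w \<in> lorentz_space n"
    using w(1) by (auto simp: m_def negative_vectors_def)
  \<comment> \<open>The projection of the origin to the hyperplane of the wall.\<close>
  define p where "p = lcomb 1 origin (snd w / m) w"
  have p: "lorentz_form n w p = 0" "p \<in> lorentz_space n" "lorentz_form n Q p = snd Q"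
      "lorentz_form n p Q = snd Q" "snd p = 1 + (snd w)\<^sup>2 / m"
      "lorentz_form n p p = 1 + (snd w)\<^sup>2 / m"
    using m w(2) lorentz_form_commute[of n Q w] wsp
    by (auto simp: p_def lorentz_form_lcomb m_def snd_lcomb power2_eq_square field_simps
        intro!: lcomb_in_lorentz_space)
  have pp: "lorentz_form n p p > 0" "snd p > 0"
    using m by (simp_all add: p add_pos_nonneg)
  define L where "L s = lcomb 1 Q s p" for s
  define f where "f s = (\<lambda>i. fst (L s) i / (sqrt (lorentz_form n (L s) (L s)) + snd (L s)))" for s
  have LL: "lorentz_form n (L s) (L s)
      = lorentz_form n Q Q + 2 * s * snd Q + s\<^sup>2 * lorentz_form n p p" for s
    using p by (simp add: L_def lorentz_form_lcomb power2_eq_square algebra_simps)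
  have sL: "snd (L s) > 0" if "s \<ge> 0" for s
    using that Q(3) pp by (simp add: L_def snd_lcomb add_pos_nonneg)
  have LL0: "lorentz_form n (L s) (L s) \<ge> 0" if "s \<ge> 0" for s
    using that Q pp by (simp add: LL)
  have wallf: "f s \<in> wall n w" if "s > 0" for s
  proof -
    define c where "c = 1 / sqrt (lorentz_form n (L s) (L s))"
    have pos: "lorentz_form n (L s) (L s) > 0"
      using that Q pp by (simp add: LL add_nonneg_pos)
    then have c: "c > 0" "c * c * lorentz_form n (L s) (L s) = 1"
        "sqrt (lorentz_form n (L s) (L s)) = 1 / c"
      by (simp_all add: c_def)
    define q where "q = lcomb c (L s) 0 Q"
    have "L s \<in> lorentz_space n"
      unfolding L_def by (intro lcomb_in_lorentz_space Q p)
    then have "q \<in> hyperboloid n"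
      using c sL[of s] that Q(1)
      by (auto simp: hyperboloid_def q_def lorentz_form_lcomb snd_lcomb mult.assoc
          intro!: lcomb_in_lorentz_space)
    moreover have "lorentz_form n w q = 0"
      using w p by (simp add: q_def L_def lorentz_form_lcomb)
    moreover have "ball_proj q = f s"
    proof -
      have "1 + snd q = c * (sqrt (lorentz_form n (L s) (L s)) + snd (L s))"
        using c by (simp add: q_def snd_lcomb algebra_simps)
      then show ?thesis
        using c(1) by (simp add: ball_proj_def f_def) (simp add: q_def lcomb_def)
    qed
    ultimately show ?thesis
      unfolding wall_def by force
  qed
  have cl: "closed (closed_wall n w)"
    unfolding closed_wall_def using closedin_closure_of closedin_Euclidean_imp_closed by blast
  have "wall n w \<subseteq> topspace (Euclidean_space n)"
    using ball_proj_in_unit_ball by (auto simp: wall_def unit_ball_def)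
  then have sub: "wall n w \<subseteq> closed_wall n w"
    unfolding closed_wall_def by (rule closure_of_subset)
  have cont: "continuous_on {0..} f"
  proof (rule continuous_on_coordinatewise_then_product)
    fix i
    show "continuous_on {0..} (\<lambda>s. f s i)"
      unfolding f_def
    proof (intro continuous_on_divide continuous_on_add continuous_on_real_sqrt)
      show "\<forall>s\<in>{0..}. sqrt (lorentz_form n (L s) (L s)) + snd (L s) \<noteq> 0"
        using sL LL0 by (metis add_nonneg_pos atLeast_iff less_irrefl real_sqrt_ge_zero)
      show "continuous_on {0..} (\<lambda>s. lorentz_form n (L s) (L s))"
        unfolding LL by (intro continuous_intros)
    qed (simp_all add: L_def lcomb_def, (intro continuous_intros)+)
  qed
  have "f ` closure {0<..} \<subseteq> closed_wall n w"
    using cont cl sub wallf by (intro image_closure_subset) auto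
  then have "f 0 \<in> closed_wall n w"
    by auto
  then show ?thesis
    by (simp add: f_def L_def lcomb_def)
qed

section \<open>Strict codes\<close>

lemma code_angle_le_hyp_angle:
  "w1 \<in> S \<Longrightarrow> w2 \<in> S \<Longrightarrow> w1 \<noteq> w2 \<Longrightarrow> code_angle n S \<le> hyp_angle n w1 w2"
  unfolding code_angle_def by (rule Inf_lower) blast

lemma code_angle_geI:
  assumes "\<theta> \<le> ereal pi"
    and "\<And>w1 w2. w1 \<in> S \<Longrightarrow> w2 \<in> S \<Longrightarrow> w1 \<noteq> w2 \<Longrightarrow> \<theta> \<le> hyp_angle n w1 w2"
  shows "\<theta> \<le> code_angle n S"
  unfolding code_angle_def using assms by (intro Inf_greatest) blast

text \<open>
  The point of hyperbolic space that a strict code leaves uncovered. The preimage of \<open>x\<close> under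
  \<^const>\<open>ball_proj\<close> is \<^term>\<open>cone_lift n x\<close> divided by \<open>1 - |x|\<^sup>2\<close>.
\<close>

lemma strict_code_witness:
  assumes "strict_code n S"
  obtains q where "q \<in> hyperboloid n" "\<And>w. w \<in> S \<Longrightarrow> lorentz_form n w q > 0"
proof -
  have "(\<Union>w\<in>S. half_space n w) \<subseteq> unit_ball n"
    using ball_proj_in_unit_ball by (auto simp: half_space_def)
  then obtain x where x: "x \<in> unit_ball n" "\<And>w. w \<in> S \<Longrightarrow> x \<notin> half_space n w"
    using assms unfolding strict_code_def by blast
  define r where "r = eucl_inner n x x"
  have r: "r < 1"
    using x(1) by (simp add: unit_ball_def r_def)
  \<comment> \<open>The second summand is zero: this is a scalar multiple.\<close>
  define q where "q = lcomb (1 / (1 - r)) (cone_lift n x) 0 origin"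
  have "cone_lift n x \<in> lorentz_space n"
    using x(1) by (auto simp: cone_lift_def lorentz_space_def unit_ball_def topspace_Euclidean_space)
  then have "q \<in> hyperboloid n"
    using r snd_cone_lift_pos[of n x] lorentz_form_cone_lift[of n x]
    by (auto simp: hyperboloid_def q_def lorentz_form_lcomb snd_lcomb power2_eq_square
        r_def[symmetric] intro!: lcomb_in_lorentz_space)
  moreover have "ball_proj q = x"
  proof
    fix i
    have "1 + snd q = 2 / (1 - r)"
      using r by (simp add: q_def snd_lcomb cone_lift_def r_def[symmetric] field_simps)
    then show "ball_proj q i = x i"
      using r by (simp add: ball_proj_def) (simp add: q_def lcomb_def cone_lift_def)
  qed
  ultimately have "lorentz_form n w q > 0" if "w \<in> S" for w
    using x(2)[OF that] by (auto simp: half_space_def not_le[symmetric])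
  with \<open>q \<in> hyperboloid n\<close> show thesis
    using that by blast
qed

text \<open>
  The code leaves the centre of the ball uncovered.
\<close>

lemma strict_codeI:
  assumes "S \<subseteq> negative_vectors n" "\<And>w. w \<in> S \<Longrightarrow> snd w > 0"
  shows "strict_code n S"
proof -
  have "(\<lambda>i. 0) \<notin> half_space n w" if "w \<in> S" for w
  proof
    assume "(\<lambda>i. 0) \<in> half_space n w"
    then obtain q where q: "q \<in> hyperboloid n" "lorentz_form n w q \<le> 0" "(\<lambda>i. 0) = ball_proj q"
      by (auto simp: half_space_def)
    have s: "snd q > 0"
      using q(1) by (simp add: hyperboloid_def)
    have "fst q i = 0" for i
      using fun_cong[OF q(3), of i] s by (simp add: ball_proj_def)
    then have "lorentz_form n w q = snd w * snd q"
      by (simp add: lorentz_form_def eucl_inner_def)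
    then show False
      using q(2) s assms(2)[OF that] by (simp add: mult_le_0_iff)
  qed
  moreover have "(\<lambda>i. 0) \<in> unit_ball n"
    by (simp add: unit_ball_def topspace_Euclidean_space eucl_inner_def)
  ultimately show ?thesis
    using assms(1) unfolding strict_code_def hyperbolic_code_def by blast
qed

text \<open>
  It suffices to bound finite subsets of codes: an infinite code contains finite subsets of
  every size.
\<close>

lemma strict_hyp_kissing_leI:
  assumes "\<And>S F. strict_code n S \<Longrightarrow> code_angle n S \<ge> ereal \<theta> \<Longrightarrow> finite F \<Longrightarrow> F \<subseteq> S \<Longrightarrow> card F \<le> B"
  shows "strict_hyp_kissing n \<theta> \<le> enat B"
  unfolding strict_hyp_kissing_def
proof (rule SUP_least)
  fix S assume S: "S \<in> {S. strict_code n S \<and> ereal \<theta> \<le> code_angle n S}"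
  then have b: "card F \<le> B" if "finite F" "F \<subseteq> S" for F
    using assms that by blast
  have "finite S"
    using b infinite_arbitrarily_large[of S "Suc B"] by force
  then show "ecard S \<le> enat B"
    using b[of S] by (simp add: ecard_def)
qed

lemma strict_hyp_kissing_geI:
  assumes "strict_code n S" "code_angle n S \<ge> ereal \<theta>" "finite S" "B \<le> card S"
  shows "enat B \<le> strict_hyp_kissing n \<theta>"
proof -
  have "enat B \<le> ecard S"
    using assms by (simp add: ecard_def)
  also have "\<dots> \<le> strict_hyp_kissing n \<theta>"
    unfolding strict_hyp_kissing_def using assms by (intro SUP_upper) simp
  finally show ?thesis .
qed

section \<open>Dimensions zero and one\<close>

lemma strict_hyp_kissing_0: "strict_hyp_kissing 0 (pi / 2) = 0"
proof -
  have "negative_vectors 0 = {}"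
    by (auto simp: negative_vectors_def lorentz_form_def eucl_inner_def not_less)
  then have "strict_hyp_kissing 0 (pi / 2) \<le> enat 0"
    by (intro strict_hyp_kissing_leI)
      (use finite_subset in \<open>auto simp: strict_code_def hyperbolic_code_def\<close>)
  then show ?thesis
    by (simp add: zero_enat_def[symmetric])
qed

text \<open>
  On the hyperbolic line a wall is a single point, so two walls meet only if the vectors are
  proportional. A negative factor makes the half-lines complementary, contradicting strictness;
  a positive one gives the angle zero.
\<close>

lemma strict_hyp_kissing_1: "strict_hyp_kissing 1 (pi / 2) = 1"
proof (rule antisym)
  have "strict_hyp_kissing 1 (pi / 2) \<le> enat 1"
  proof (rule strict_hyp_kissing_leI)
    fix S F :: "((nat \<Rightarrow> real) \<times> real) set"
    assume S: "strict_code 1 S" "ereal (pi / 2) \<le> code_angle 1 S" and F: "finite F" "F \<subseteq> S"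
    obtain q where q: "q \<in> hyperboloid 1" "\<And>w. w \<in> S \<Longrightarrow> lorentz_form 1 w q > 0"
      using strict_code_witness[OF S(1)] by blast
    have "w1 = w2" if "w1 \<in> S" "w2 \<in> S" for w1 w2
    proof (rule ccontr)
      assume "w1 \<noteq> w2"
      then have "hyp_angle 1 w1 w2 \<ge> ereal (pi / 2)"
        using code_angle_le_hyp_angle S(2) that by (meson order_trans)
      moreover have neg: "w1 \<in> negative_vectors 1" "w2 \<in> negative_vectors 1"
        using S(1) that by (auto simp: strict_code_def hyperbolic_code_def)
      ultimately obtain x where x: "lorentz_form 1 w1 (cone_lift 1 x) = 0"
          "lorentz_form 1 w2 (cone_lift 1 x) = 0" "lorentz_form 1 w1 w2 \<ge> 0"
        using right_angle_condition by metis
      \<comment> \<open>Both vectors lie on the line orthogonal to the common point of their walls.\<close>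
      define k where "k = 2 * x 0 / (1 + x 0 * x 0)"
      have pos: "1 + x 0 * x 0 > 0"
        by (simp add: add_pos_nonneg)
      have k: "snd w1 = k * fst w1 0" "snd w2 = k * fst w2 0"
        using x(1,2) pos
        by (simp_all add: lorentz_form_def cone_lift_def eucl_inner_def k_def field_simps)
      have "fst w1 0 * fst w1 0 * (1 - k * k) > 0"
        using neg(1) by (simp add: negative_vectors_def lorentz_form_def eucl_inner_def k algebra_simps)
      then have "1 - k * k > 0"
        by (metis mult_less_cancel_left_disj mult_zero_right not_square_less_zero)
      moreover have "fst w1 0 * fst w2 0 * (1 - k * k) \<le> 0"
        using x(3) by (simp add: lorentz_form_def eucl_inner_def k algebra_simps)
      ultimately have "fst w1 0 * fst w2 0 \<le> 0"
        by (simp add: mult_le_0_iff)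
      then have "(fst w1 0 * fst w2 0) * (k * snd q - fst q 0)\<^sup>2 \<le> 0"
        by (simp add: mult_le_0_iff)
      moreover have "lorentz_form 1 w1 q * lorentz_form 1 w2 q > 0"
        using q(2) that by simp
      moreover have "lorentz_form 1 w1 q * lorentz_form 1 w2 q
          = (fst w1 0 * fst w2 0) * (k * snd q - fst q 0)\<^sup>2"
        by (simp add: lorentz_form_def eucl_inner_def k power2_eq_square algebra_simps)
      ultimately show False by simp
    qed
    then show "card F \<le> 1"
      using F by (metis card_le_Suc0_iff_eq One_nat_def subsetD)
  qed
  then show "strict_hyp_kissing 1 (pi / 2) \<le> 1"
    by (simp add: one_enat_def)
  define w :: "(nat \<Rightarrow> real) \<times> real" where "w = (\<lambda>i. if i = 0 then 2 else 0, 1)"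
  have "strict_code 1 {w}"
    by (rule strict_codeI)
      (auto simp: w_def negative_vectors_def lorentz_space_def topspace_Euclidean_space
        lorentz_form_def eucl_inner_def)
  moreover have "{hyp_angle 1 w1 w2 | w1 w2. w1 \<in> {w} \<and> w2 \<in> {w} \<and> w1 \<noteq> w2} = {}"
    by blast
  then have "code_angle 1 {w} = ereal pi"
    unfolding code_angle_def by (simp only:) simp
  ultimately have "enat 1 \<le> strict_hyp_kissing 1 (pi / 2)"
    by (intro strict_hyp_kissing_geI[of _ "{w}"]) auto
  then show "1 \<le> strict_hyp_kissing 1 (pi / 2)"
    by (simp add: one_enat_def)
qed

section \<open>The lower bound\<close>

text \<open>
  A graph of maximal degree one is a matching together with isolated vertices; keeping one end
  of each edge keeps at least half of the vertices.
\<close>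

lemma independent_half_of_matching:
  assumes "finite A"
    and sym: "\<And>a b. R a b \<Longrightarrow> R b a"
    and unique: "\<And>a b c. a \<in> A \<Longrightarrow> b \<in> A \<Longrightarrow> c \<in> A \<Longrightarrow> R a b \<Longrightarrow> R a c \<Longrightarrow> b = c"
  shows "\<exists>T\<subseteq>A. card A \<le> 2 * card T \<and> (\<forall>a\<in>T. \<forall>b\<in>T. a \<noteq> b \<longrightarrow> \<not> R a b)"
  using assms(1) unique
proof (induction A rule: finite_psubset_induct)
  case (psubset A)
  show ?case
  proof (cases "\<exists>a\<in>A. \<exists>b\<in>A. a \<noteq> b \<and> R a b")
    case False
    then show ?thesis by (intro exI[of _ A]) auto
  next
    case True
    then obtain a b where ab: "a \<in> A" "b \<in> A" "a \<noteq> b" "R a b" by blast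
    let ?B = "A - {a, b}"
    have "\<exists>T\<subseteq>?B. card ?B \<le> 2 * card T \<and> (\<forall>a\<in>T. \<forall>b\<in>T. a \<noteq> b \<longrightarrow> \<not> R a b)"
      using ab by (intro psubset.IH) (auto intro: psubset.prems)
    then obtain T where T: "T \<subseteq> ?B" "card ?B \<le> 2 * card T"
        "\<forall>a\<in>T. \<forall>b\<in>T. a \<noteq> b \<longrightarrow> \<not> R a b" by blast
    have "card ?B = card A - 2"
      using ab psubset.hyps by (subst card_Diff_subset) auto
    moreover have "card (insert a T) = Suc (card T)"
      using T(1) psubset.hyps by (subst card_insert_disjoint) (auto intro: finite_subset)
    moreover have "\<not> R a c" if "c \<in> T" for c
      using psubset.prems[OF ab(1,2) _ ab(4)] that T(1) by blast
    then have "\<forall>x\<in>insert a T. \<forall>y\<in>insert a T. x \<noteq> y \<longrightarrow> \<not> R x y"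
      using T(3) sym by blast
    ultimately show ?thesis
      using T(1,2) ab(1) by (intro exI[of _ "insert a T"]) auto
  qed
qed

lemma eucl_inner_unit_bound:
  assumes "eucl_inner d x x = 1" "eucl_inner d y y = 1"
  shows "\<bar>eucl_inner d x y\<bar> \<le> 1"
  using eucl_inner_Cauchy_Schwarz[of d x y] assms by (simp add: abs_square_le_1)

text \<open>
  Two points at angle less than \<open>\<phi>\<^sub>0 = arccos (3/4)\<close> from \<open>-x\<close> are at angle less than
  \<open>2\<phi>\<^sub>0 = arccos (1/8)\<close> from each other. In terms of inner products this is the Cauchy-Schwarz
  inequality for \<open>x\<close> and \<open>y + z\<close>.
\<close>

lemma near_antipodes_close:
  assumes unit: "eucl_inner d x x = 1" "eucl_inner d y y = 1" "eucl_inner d z z = 1"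
    and far: "eucl_inner d x y < -3/4" "eucl_inner d x z < -3/4"
  shows "eucl_inner d y z > 1/8"
proof -
  define s where "s = (\<lambda>i. 1 * y i + 1 * z i)"
  have sl: "eucl_inner d s v = eucl_inner d y v + eucl_inner d z v" for v
    using eucl_inner_combination_left[of d 1 y 1 z v] by (simp add: s_def)
  have xs: "eucl_inner d x s = eucl_inner d x y + eucl_inner d x z"
    using sl[of x] eucl_inner_commute by metis
  have ss: "eucl_inner d s s = 2 + 2 * eucl_inner d y z"
    unfolding sl eucl_inner_commute[of d y s] eucl_inner_commute[of d z s]
    using unit eucl_inner_commute[of d z y] by simp
  have "(3/2)\<^sup>2 < (- eucl_inner d x s)\<^sup>2"
    using far xs by (intro power_strict_mono) auto
  also have "\<dots> \<le> eucl_inner d x x * eucl_inner d s s"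
    using eucl_inner_Cauchy_Schwarz[of d x s] by simp
  finally show ?thesis
    using unit ss by (simp add: power2_eq_square)
qed

text \<open>
  Walls of vectors of equal norm and equal last coordinate are exchanged by a reflection that
  fixes the origin. A symmetric common point is therefore found among the combinations of the
  origin and \<open>w1 + w2\<close>; orthogonality to \<open>w1\<close> determines the coefficients. In the limiting
  case \<open>lorentz_form n w1 w2 = - lorentz_form n w1 w1\<close> the vector \<open>Q\<close> is null, and the walls
  meet at an ideal point.
\<close>

lemma closed_walls_meet:
  assumes w: "w1 \<in> negative_vectors n" "w2 \<in> negative_vectors n"
    and eq: "lorentz_form n w1 w1 = lorentz_form n w2 w2" "snd w1 = snd w2"
    and le: "lorentz_form n w1 w2 \<le> - lorentz_form n w1 w1"
    and pos: "snd w1 > 0"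
  shows "closed_wall n w1 \<inter> closed_wall n w2 \<noteq> {}"
proof -
  let ?b = "lorentz_form n w1 w2" and ?m = "- lorentz_form n w1 w1" and ?u = "snd w1"
  define Q where "Q = lcomb (?m - ?b) origin ?u (lcomb 1 w1 1 w2)"
  have "w1 \<in> lorentz_space n" "w2 \<in> lorentz_space n"
    using w by (auto simp: negative_vectors_def)
  then have "Q \<in> lorentz_space n"
    unfolding Q_def by (intro lcomb_in_lorentz_space) auto
  moreover have perp: "lorentz_form n w1 Q = 0" "lorentz_form n w2 Q = 0"
    using eq lorentz_form_commute[of n w2 w1]
    by (simp_all add: Q_def lorentz_form_lcomb algebra_simps)
  moreover have sQ: "snd Q > 0"
    using le pos eq by (simp add: Q_def snd_lcomb add_nonneg_pos)
  moreover have "lorentz_form n Q Q = (?m - ?b) * snd Q"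
  proof -
    have "lorentz_form n Q r = (?m - ?b) * snd r + ?u * (lorentz_form n w1 r + lorentz_form n w2 r)"
      for r
      by (simp add: Q_def lorentz_form_lcomb_left)
    then show ?thesis by (simp add: perp)
  qed
  then have "lorentz_form n Q Q \<ge> 0"
    using le sQ by simp
  ultimately show ?thesis
    using projection_in_closed_wall w by blast
qed

lemma eucl_inner_le_cos:
  assumes "eucl_inner d x x = 1" "eucl_inner d y y = 1" "sph_angle d x y \<ge> \<phi>" "0 \<le> \<phi>"
  shows "eucl_inner d x y \<le> cos \<phi>"
proof -
  have b: "\<bar>eucl_inner d x y\<bar> \<le> 1"
    using assms eucl_inner_unit_bound by blast
  then have "eucl_inner d x y = cos (sph_angle d x y)"
    by (simp add: sph_angle_def cos_arccos_abs)
  also have "\<dots> \<le> cos \<phi>"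
    using assms b by (intro cos_monotone_0_pi_le) (auto simp: sph_angle_def arccos_ubound)
  finally show ?thesis .
qed

lemma arccos_three_quarters: "0 < arccos (3/4 :: real)" "2 * arccos (3/4 :: real) \<le> pi"
  using arccos_less_arccos[of "3/4" 1] arccos_le_arccos[of 0 "3/4 :: real"] by simp_all

text \<open>
  Start from an optimal spherical code \<open>A\<close> of angle \<open>2\<phi>\<^sub>0\<close>, so that inner products are at most
  \<open>1/8\<close>. By \<open>near_antipodes_close\<close> each point has inner product below \<open>-3/4\<close> with at most one
  other, so half of the code survives with all inner products in \<open>[-3/4, 1/8]\<close>. Squared
  distances then lie in \<open>[7/4, 7/2]\<close>, which is \<open>[2r\<^sup>2, 4r\<^sup>2]\<close> for \<open>r\<^sup>2 = 7/8\<close>: spheres of radius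
  \<open>r\<close> around these points meet, with outward normals at angle at least \<open>\<pi>/2\<close>. The hemispheres
  over them in the upper half-space model form the required code.
\<close>

lemma strict_hyp_kissing_lower:
  assumes "n \<ge> 1"
  shows "enat (spherical_kissing (n - 1) (2 * arccos (3/4)) div 2) \<le> strict_hyp_kissing n (pi / 2)"
proof -
  define d where "d = n - 1"
  have n: "n = Suc d"
    using assms by (simp add: d_def)
  let ?\<phi> = "2 * arccos (3/4 :: real)"
  obtain A where A: "spherical_code d ?\<phi> A" "finite A" "card A = spherical_kissing d ?\<phi>"
    using spherical_kissing_attained[of ?\<phi> d] arccos_three_quarters by auto
  have unit: "eucl_inner d y y = 1" "\<forall>i\<ge>d. y i = 0" if "y \<in> A" for y
    using A(1) that by (auto simp: spherical_code_def unit_sphere_def topspace_Euclidean_space)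
  have cos: "cos ?\<phi> = 1/8"
    by (simp add: cos_double_cos power2_eq_square)
  have close: "eucl_inner d y z \<le> 1/8" if "y \<in> A" "z \<in> A" "y \<noteq> z" for y z
    using eucl_inner_le_cos[of d y z ?\<phi>] unit that A(1) arccos_three_quarters(1) cos
    by (auto simp: spherical_code_def)
  have "\<exists>T\<subseteq>A. card A \<le> 2 * card T \<and>
      (\<forall>y\<in>T. \<forall>z\<in>T. y \<noteq> z \<longrightarrow> \<not> eucl_inner d y z < -3/4)"
  proof (rule independent_half_of_matching)
    fix x y z assume "x \<in> A" "y \<in> A" "z \<in> A" "eucl_inner d x y < -3/4" "eucl_inner d x z < -3/4"
    then show "y = z"
      using near_antipodes_close[of d x y z] close[of y z] unit by force
  qed (use A eucl_inner_commute in auto)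
  then obtain T where T: "T \<subseteq> A" "card A \<le> 2 * card T"
      "\<And>y z. y \<in> T \<Longrightarrow> z \<in> T \<Longrightarrow> y \<noteq> z \<Longrightarrow> eucl_inner d y z \<ge> -3/4"
    by (meson not_less)
  \<comment> \<open>The Lorentz vector of the hemisphere of radius \<open>r\<close> over \<open>y\<close>, where \<open>(e\<^sub>d; 1)\<close> is the point at
    infinity: its last coordinates \<open>a\<close> and \<open>b\<close> satisfy \<open>b - a = 1\<close> and
    \<open>b + a = |y|\<^sup>2 - r\<^sup>2 = 1/8\<close>.\<close>
  define W :: "(nat \<Rightarrow> real) \<Rightarrow> (nat \<Rightarrow> real) \<times> real"
    where "W y = (\<lambda>i. if i = d then -7/16 else y i, 9/16)" for y
  have form: "lorentz_form n (W y) (W z) = 1/8 - eucl_inner d y z" for y z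
    by (simp add: lorentz_form_def W_def eucl_inner_def n)
  have neg: "W y \<in> negative_vectors n" "lorentz_form n (W y) (W y) = -7/8" if "y \<in> T" for y
    using unit[of y] that T(1) form[of y y]
    by (auto simp: negative_vectors_def lorentz_space_def topspace_Euclidean_space n W_def)
  have snd: "snd (W y) = 9/16" "snd (W y) > 0" for y
    by (simp_all add: W_def)
  have inj: "inj_on W T"
  proof (rule inj_onI)
    fix y z assume yz: "y \<in> T" "z \<in> T" "W y = W z"
    show "y = z"
    proof (rule ccontr)
      assume "y \<noteq> z"
      moreover have "eucl_inner d y y = eucl_inner d y z"
        using form[of y y] form[of y z] yz(3) by simp
      ultimately show False
        using close[of y z] unit(1)[of y] yz(1,2) T(1) by auto
    qed
  qed
  have angle: "hyp_angle n (W y) (W z) \<ge> ereal (pi / 2)" if "y \<in> T" "z \<in> T" "y \<noteq> z" for y z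
  proof -
    have b: "lorentz_form n (W y) (W z) \<ge> 0" "lorentz_form n (W y) (W z) \<le> 7/8"
      using close[of y z] T(3)[OF that] that T(1) by (auto simp: form)
    have meet: "closed_wall n (W y) \<inter> closed_wall n (W z) \<noteq> {}"
      using that neg b by (intro closed_walls_meet) (auto simp: snd)
    have "arccos 0 \<le> arccos (- lorentz_form n (W y) (W z) / (7/8))"
      using b by (intro arccos_le_arccos) auto
    moreover have root: "sqrt (lorentz_form n (W y) (W y) * lorentz_form n (W z) (W z)) = 7/8"
      unfolding neg(2)[OF that(1)] neg(2)[OF that(2)]
      by (intro real_sqrt_unique) (simp_all add: power2_eq_square)
    ultimately show ?thesis
      unfolding hyp_angle_def if_P[OF meet] root by simp
  qed
  have "enat (card A div 2) \<le> strict_hyp_kissing n (pi / 2)"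
  proof (rule strict_hyp_kissing_geI)
    show "strict_code n (W ` T)"
      using neg(1) snd(2) by (intro strict_codeI) blast+
    show "ereal (pi / 2) \<le> code_angle n (W ` T)"
    proof (rule code_angle_geI)
      fix w1 w2 assume "w1 \<in> W ` T" "w2 \<in> W ` T" "w1 \<noteq> w2"
      then show "ereal (pi / 2) \<le> hyp_angle n w1 w2"
        using angle by blast
    qed simp
    show "finite (W ` T)" "card A div 2 \<le> card (W ` T)"
      using T A(2) by (auto simp: card_image[OF inj] intro: finite_subset)
  qed
  then show ?thesis
    using A(3) d_def by simp
qed

section \<open>The upper bound\<close>

text \<open>
  An isometric copy in \<open>\<real>\<^sup>d\<close> of the orthogonal projection of \<open>\<real>\<^bsup>d+1\<^esup>\<close> along a unit vector \<open>e\<close>: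
  reflect \<open>e\<close> to the last basis vector and drop the last coordinate. Below, \<open>k x\<close> is the coefficient
  of \<open>e - e\<^sub>d\<close> in the reflection; for \<open>e = e\<^sub>d\<close> division by zero makes it vanish, and the
  reflection becomes the identity.
\<close>

lemma unit_complement_projection:
  assumes e: "eucl_inner (Suc d) e e = 1"
  obtains T where "\<And>x. T x \<in> topspace (Euclidean_space d)"
    "\<And>x y. eucl_inner d (T x) (T y)
      = eucl_inner (Suc d) x y - eucl_inner (Suc d) x e * eucl_inner (Suc d) y e"
proof -
  define k where "k x = (eucl_inner (Suc d) x e - x d) / (1 - e d)" for x
  define T where "T x = (\<lambda>i. if i < d then x i - k x * e i else 0)" for x
  have "eucl_inner d (T x) (T y)
      = eucl_inner (Suc d) x y - eucl_inner (Suc d) x e * eucl_inner (Suc d) y e" for x y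
  proof -
    define \<alpha> \<beta> where "\<alpha> = eucl_inner d x e" and "\<beta> = eucl_inner d y e"
    have "eucl_inner d (T x) (T y) = eucl_inner d (\<lambda>i. 1 * x i + (- k x) * e i) (\<lambda>i. 1 * y i + (- k y) * e i)"
      by (simp add: eucl_inner_def T_def)
    also have "\<dots> = eucl_inner d x y - k x * \<beta> - k y * \<alpha> + k x * k y * eucl_inner d e e"
      unfolding eucl_inner_combination_left
      by (subst (1 2) eucl_inner_commute, unfold eucl_inner_combination_left)
        (simp add: \<alpha>_def \<beta>_def eucl_inner_commute algebra_simps)
    also have "\<dots> = eucl_inner (Suc d) x y - eucl_inner (Suc d) x e * eucl_inner (Suc d) y e"
    proof (cases "e d = 1")
      case True
      then have "eucl_inner d e e = 0"
        using e by (simp add: eucl_inner_def)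
      then have "\<forall>i\<in>{..<d}. e i * e i = 0"
        unfolding eucl_inner_def by (subst (asm) sum_nonneg_eq_0_iff) auto
      then have "eucl_inner d z e = 0" for z
        by (simp add: eucl_inner_def)
      then show ?thesis
        using True by (simp add: k_def \<alpha>_def \<beta>_def) (simp add: eucl_inner_def)
    next
      case False
      have ee: "eucl_inner d e e = (1 - e d) * (1 + e d)"
        using e by (simp add: eucl_inner_def algebra_simps)
      have k: "k x * (1 - e d) = \<alpha> + x d * e d - x d" "k y * (1 - e d) = \<beta> + y d * e d - y d"
        using False by (simp_all add: k_def \<alpha>_def \<beta>_def) (simp_all add: eucl_inner_def)
      have "\<alpha> = k x * (1 - e d) + x d * (1 - e d)" "\<beta> = k y * (1 - e d) + y d * (1 - e d)"
        using k by (simp_all add: algebra_simps)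
      then have "- k x * \<beta> - k y * \<alpha> + k x * k y * ((1 - e d) * (1 + e d))
          = x d * y d - (\<alpha> + x d * e d) * (\<beta> + y d * e d)"
        by algebra
      then show ?thesis
        unfolding ee by (simp add: \<alpha>_def \<beta>_def eucl_inner_def)
    qed
    finally show ?thesis .
  qed
  moreover have "T x \<in> topspace (Euclidean_space d)" for x
    by (simp add: T_def topspace_Euclidean_space)
  ultimately show thesis
    using that by blast
qed

text \<open>
  The case of smallest radius one in \<open>kissing_cosine_bound\<close>. Equality holds at
  \<open>g = h = 1\<close>, \<open>A = B = 4\<close>, which is the configuration of three unit balls of which the
  second and third touch the first. The two lower bounds for \<open>A\<close> cross at \<open>g = 1\<close>, so the
  stronger one depends on the side of \<open>1\<close> on which \<open>g\<close> lies.
\<close>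

lemma scaled_cosine_bound:
  fixes g h A B :: real
  assumes "g \<ge> 0" "h \<ge> 0" "A \<ge> 2 + 2 * g" "A \<ge> (1 + g)\<^sup>2" "B \<ge> 2 + 2 * h" "B \<ge> (1 + h)\<^sup>2"
  shows "16 * (1 + g + h)\<^sup>2 \<le> 9 * (A * B)"
proof -
  have mixed: "16 * (1 + x + y)\<^sup>2 \<le> 9 * ((2 + 2 * x) * (1 + y)\<^sup>2)" if "0 \<le> x" "x \<le> 1" "1 \<le> y" for x y :: real
  proof -
    have "9 * ((2 + 2 * x) * (1 + y)\<^sup>2) - 16 * (1 + x + y)\<^sup>2
        = 2 * (((1 + y)\<^sup>2 - 4) + x * (1 + y) * (9 * (1 + y) - 18) + 2 * (x * (y - 1))
           + 4 * ((1 - x) * (1 + 2 * x)))"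
      by (simp add: power2_eq_square algebra_simps)
    also have "\<dots> \<ge> 0"
      using that power_mono[of 2 "1 + y" 2]
      by (intro mult_nonneg_nonneg add_nonneg_nonneg) auto
    finally show ?thesis by simp
  qed
  consider "g \<ge> 1" "h \<ge> 1" | "g \<le> 1" "h \<ge> 1" | "g \<ge> 1" "h \<le> 1" | "g \<le> 1" "h \<le> 1"
    by linarith
  then show ?thesis
  proof cases
    case 1
    have "3 * ((1 + g) * (1 + h)) - 4 * (1 + g + h) = (g - 1) * (h - 1) + 2 * (g * h - 1)"
      by (simp add: algebra_simps)
    also have "\<dots> \<ge> 0"
      using 1 mult_mono[of 1 g 1 h] by (intro add_nonneg_nonneg mult_nonneg_nonneg) auto
    finally have "4 * (1 + g + h) \<le> 3 * ((1 + g) * (1 + h))"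
      by simp
    then have "(4 * (1 + g + h))\<^sup>2 \<le> (3 * ((1 + g) * (1 + h)))\<^sup>2"
      using assms by (intro power_mono) auto
    then have "16 * (1 + g + h)\<^sup>2 \<le> 9 * ((1 + g)\<^sup>2 * (1 + h)\<^sup>2)"
      unfolding power_mult_distrib by simp
    also have "\<dots> \<le> 9 * (A * B)"
      using assms by (intro mult_left_mono mult_mono) auto
    finally show ?thesis .
  next
    case 2
    have "9 * ((2 + 2 * g) * (1 + h)\<^sup>2) \<le> 9 * (A * B)"
      using assms by (intro mult_left_mono mult_mono) auto
    with mixed[of g h] 2 assms show ?thesis by linarith
  next
    case 3
    have "9 * ((1 + g)\<^sup>2 * (2 + 2 * h)) \<le> 9 * (A * B)"
      using assms by (intro mult_left_mono mult_mono) auto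
    with mixed[of h g] 3 assms show ?thesis by (simp add: algebra_simps)
  next
    case 4
    \<comment> \<open>Here \<open>g * h \<ge> s - 1\<close> because \<open>(1 - g) * (1 - h) \<ge> 0\<close>.\<close>
    define s where "s = g + h"
    have s: "0 \<le> s" "s \<le> 2" and p: "g * h \<ge> 0" "g * h \<ge> s - 1"
      using 4 assms mult_nonneg_nonneg[of "1 - g" "1 - h"] by (auto simp: s_def algebra_simps)
    have "4 * (1 + s)\<^sup>2 \<le> 9 * (1 + s + g * h)"
    proof (cases "s \<le> 1")
      case True
      then have "s * s \<le> 1"
        using s mult_mono[of s 1 s 1] by simp
      with True p s show ?thesis by (simp add: power2_eq_square algebra_simps)
    next
      case False
      then have "(2 * s - 1) * (s - 2) \<le> 0"
        using s by (intro mult_nonneg_nonpos) auto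
      with p show ?thesis by (simp add: power2_eq_square algebra_simps)
    qed
    then have "16 * (1 + g + h)\<^sup>2 \<le> 9 * ((2 + 2 * g) * (2 + 2 * h))"
      by (simp add: s_def power2_eq_square algebra_simps)
    also have "\<dots> \<le> 9 * (A * B)"
      using assms by (intro mult_left_mono mult_mono) auto
    finally show ?thesis .
  qed
qed

text \<open>
  The ideal endpoint \<open>p\<close> of the geodesic ray from \<open>q\<close> that crosses the wall of \<open>w\<close> orthogonally is
  the centre of the cap of \<open>w\<close> as seen from \<open>q\<close>. A half-space that avoids \<open>q\<close> and whose outward
  normal makes no acute angle with that of \<open>w\<close> cannot reach this centre.
\<close>

lemma ideal_point_of_cap:
  assumes w: "lorentz_form n w w < 0" "lorentz_form n w q > 0" and q: "lorentz_form n q q = 1"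
  obtains p where "lorentz_form n p p = 0"
    "\<And>w'. lorentz_form n w' q > 0 \<Longrightarrow> lorentz_form n w w' \<ge> 0 \<Longrightarrow> lorentz_form n w' p > 0"
proof -
  define m h where "m = - lorentz_form n w w" and "h = lorentz_form n w q"
  have mh: "m > 0" "h > 0"
    using w by (auto simp: m_def h_def)
  \<comment> \<open>The positive root of the quadratic equation that says that \<open>a q + w\<close> is a null vector.\<close>
  define a where "a = sqrt (h\<^sup>2 + m) - h"
  have "sqrt (h\<^sup>2) < sqrt (h\<^sup>2 + m)"
    using mh by (subst real_sqrt_less_iff) simp
  then have a: "a > 0"
    using mh by (simp add: a_def)
  have "(a + h)\<^sup>2 = h\<^sup>2 + m"
    using mh by (simp add: a_def)
  then have root: "a * a + 2 * a * h - m = 0"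
    by (simp add: power2_eq_square algebra_simps)
  define p where "p = lcomb a q 1 w"
  have "lorentz_form n p p = a * a + 2 * a * h - m"
    using q lorentz_form_commute[of n q w]
    by (simp add: p_def lorentz_form_lcomb m_def h_def algebra_simps)
  then have "lorentz_form n p p = 0"
    using root by simp
  moreover have "lorentz_form n w' p > 0" if "lorentz_form n w' q > 0" "lorentz_form n w w' \<ge> 0" for w'
    using that a lorentz_form_commute[of n w w']
    by (simp add: p_def lorentz_form_lcomb add_pos_nonneg)
  ultimately show thesis
    using that by blast
qed

text \<open>
  The orthogonal complement of a null vector \<open>p\<close>, modulo \<open>p\<close>, is a Euclidean space with the
  negative of the form. It is the translation space of the boundary of the upper half-space
  model with \<open>p\<close> at infinity.
\<close>

lemma null_complement_projection:
  assumes p: "lorentz_form (Suc d) p p = 0" "snd p \<noteq> 0"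
  obtains T where "\<And>x. T x \<in> topspace (Euclidean_space d)"
    "\<And>x y. lorentz_form (Suc d) x p = 0 \<Longrightarrow> lorentz_form (Suc d) y p = 0 \<Longrightarrow>
        eucl_inner d (T x) (T y) = - lorentz_form (Suc d) x y"
proof -
  define e where "e = (\<lambda>i. 1 / snd p * fst p i)"
  have "eucl_inner (Suc d) (fst p) (fst p) = (snd p)\<^sup>2"
    using p(1) by (simp add: lorentz_form_def power2_eq_square)
  then have "eucl_inner (Suc d) e e = 1"
    unfolding e_def eucl_inner_scale using p(2) by (simp add: power2_eq_square)
  then obtain T where T: "\<And>x. T x \<in> topspace (Euclidean_space d)"
    "\<And>x y. eucl_inner d (T x) (T y)
      = eucl_inner (Suc d) x y - eucl_inner (Suc d) x e * eucl_inner (Suc d) y e"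
    using unit_complement_projection by blast
  have xe: "eucl_inner (Suc d) (fst x) e = snd x" if "lorentz_form (Suc d) x p = 0" for x
  proof -
    have "eucl_inner (Suc d) (fst x) e = 1 / snd p * eucl_inner (Suc d) (fst x) (fst p)"
      using eucl_inner_scale[of "Suc d" 1 "fst x" "1 / snd p" "fst p"] by (simp add: e_def)
    then show ?thesis
      using that p(2) by (simp add: lorentz_form_def divide_eq_eq)
  qed
  show thesis
    by (rule that[of "T \<circ> fst"]) (simp_all add: T xe lorentz_form_def)
qed

text \<open>
  Balls of radii \<open>r\<close>, \<open>s\<close> meet a smallest ball of radius \<open>\<rho>\<close> centred at the origin, each at
  a squared distance \<open>r\<^sup>2 + \<rho>\<^sup>2 + 2 * g\<close> between \<open>r\<^sup>2 + \<rho>\<^sup>2\<close> and \<open>(r + \<rho>)\<^sup>2\<close>. If their mutual squared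
  distance is at least \<open>r\<^sup>2 + s\<^sup>2\<close>, then the left-hand side bounds the inner product of their
  centres, so these are seen from the origin at angle at least \<open>arccos (3/4)\<close>.
\<close>

lemma kissing_cosine_bound:
  fixes \<rho> r s g h :: real
  assumes \<rho>: "0 < \<rho>" and r: "\<rho> \<le> r" "0 \<le> g" "g \<le> r * \<rho>" and s: "\<rho> \<le> s" "0 \<le> h" "h \<le> s * \<rho>"
  shows "\<rho>\<^sup>2 + g + h \<le> 3/4 * (sqrt (r\<^sup>2 + \<rho>\<^sup>2 + 2 * g) * sqrt (s\<^sup>2 + \<rho>\<^sup>2 + 2 * h))"
proof -
  have scaled: "0 \<le> x / \<rho>\<^sup>2" "(t\<^sup>2 + \<rho>\<^sup>2 + 2 * x) / \<rho>\<^sup>2 \<ge> 2 + 2 * (x / \<rho>\<^sup>2)"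
      "(t\<^sup>2 + \<rho>\<^sup>2 + 2 * x) / \<rho>\<^sup>2 \<ge> (1 + x / \<rho>\<^sup>2)\<^sup>2"
    if "\<rho> \<le> t" "0 \<le> x" "x \<le> t * \<rho>" for t x
  proof -
    define y where "y = x / \<rho>\<^sup>2"
    define u where "u = t / \<rho>"
    have y: "0 \<le> y" "y \<le> u" "1 \<le> u"
      using that \<rho> by (simp_all add: y_def u_def field_simps power2_eq_square)
    have eq: "(t\<^sup>2 + \<rho>\<^sup>2 + 2 * x) / \<rho>\<^sup>2 = u\<^sup>2 + 1 + 2 * y"
      using \<rho> by (simp add: y_def u_def field_simps)
    have "1 \<le> u\<^sup>2" "y\<^sup>2 \<le> u\<^sup>2"
      using y by (auto intro: power_mono)
    then show "0 \<le> x / \<rho>\<^sup>2" "(t\<^sup>2 + \<rho>\<^sup>2 + 2 * x) / \<rho>\<^sup>2 \<ge> 2 + 2 * (x / \<rho>\<^sup>2)"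
      "(t\<^sup>2 + \<rho>\<^sup>2 + 2 * x) / \<rho>\<^sup>2 \<ge> (1 + x / \<rho>\<^sup>2)\<^sup>2"
      unfolding eq y_def[symmetric] using y by (simp_all add: power2_sum)
  qed
  define A B where "A = r\<^sup>2 + \<rho>\<^sup>2 + 2 * g" and "B = s\<^sup>2 + \<rho>\<^sup>2 + 2 * h"
  have "16 * (1 + g / \<rho>\<^sup>2 + h / \<rho>\<^sup>2)\<^sup>2 \<le> 9 * (A / \<rho>\<^sup>2 * (B / \<rho>\<^sup>2))"
    unfolding A_def B_def by (intro scaled_cosine_bound scaled[OF r] scaled[OF s])
  moreover have "1 + g / \<rho>\<^sup>2 + h / \<rho>\<^sup>2 = (\<rho>\<^sup>2 + g + h) / \<rho>\<^sup>2"
    using \<rho> by (simp add: field_simps)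
  moreover have "9 * (A / \<rho>\<^sup>2 * (B / \<rho>\<^sup>2)) = 9 * (A * B) / (\<rho>\<^sup>2)\<^sup>2"
    by (simp add: power2_eq_square[of "\<rho>\<^sup>2"])
  ultimately have "16 * (\<rho>\<^sup>2 + g + h)\<^sup>2 / (\<rho>\<^sup>2)\<^sup>2 \<le> 9 * (A * B) / (\<rho>\<^sup>2)\<^sup>2"
    by (simp add: power_divide)
  then have "16 * (\<rho>\<^sup>2 + g + h)\<^sup>2 \<le> 9 * (A * B)"
    using \<rho> by (subst (asm) divide_le_cancel) auto
  then have "(\<rho>\<^sup>2 + g + h)\<^sup>2 \<le> (3/4 * sqrt (A * B))\<^sup>2"
    using r s by (simp add: power_mult_distrib A_def B_def power2_eq_square)
  then have "\<rho>\<^sup>2 + g + h \<le> 3/4 * sqrt (A * B)"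
    by (rule power2_le_imp_le) (use r s in \<open>simp add: A_def B_def\<close>)
  then show ?thesis
    by (simp add: A_def B_def real_sqrt_mult)
qed

text \<open>
  With \<open>p\<close> at infinity, \<open>w / lorentz_form n w p\<close> encodes the ball of radius \<open>r w\<close> on the boundary
  of the upper half-space, and the difference of two such vectors is the difference of the
  centres. The directions from the centre of a smallest ball to the other centres form a
  spherical code.
\<close>

lemma obtuse_balls_card_le:
  assumes fin: "finite F"
    and p: "lorentz_form n p p = 0" "snd p \<noteq> 0" and n: "n \<ge> 1"
    and neg: "\<And>w. w \<in> F \<Longrightarrow> lorentz_form n w w < 0"
    and pos: "\<And>w. w \<in> F \<Longrightarrow> lorentz_form n w p > 0"
    and pair: "\<And>w w'. w \<in> F \<Longrightarrow> w' \<in> F \<Longrightarrow> w \<noteq> w' \<Longrightarrow> lorentz_form n w w' \<ge> 0 \<and>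
       (lorentz_form n w w')\<^sup>2 \<le> lorentz_form n w w * lorentz_form n w' w'"
  shows "card F \<le> spherical_kissing (n - 1) (arccos (3/4)) + 1"
proof (cases "F = {}")
  case False
  define d where "d = n - 1"
  have nd: "n = Suc d"
    using n by (simp add: d_def)
  define r where "r w = sqrt (- lorentz_form n w w) / lorentz_form n w p" for w
  obtain w0 where w0: "w0 \<in> F" "\<And>w. w \<in> F \<Longrightarrow> r w0 \<le> r w"
    using fin False arg_min_if_finite[of F r] by (metis not_less)
  have rpos: "r w > 0" if "w \<in> F" for w
    using that neg pos by (simp add: r_def)
  define z where "z w = lcomb (1 / lorentz_form n w p) w (- (1 / lorentz_form n w0 p)) w0" for w
  define c where "c w w' = lorentz_form n w w' / (lorentz_form n w p * lorentz_form n w' p)" for w w'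
  have cself: "c w w = - (r w)\<^sup>2" if "w \<in> F" for w
    using neg[OF that] by (simp add: c_def r_def power_divide power2_eq_square)
  have c: "0 \<le> c w w'" "c w w' \<le> r w * r w'" if "w \<in> F" "w' \<in> F" "w \<noteq> w'" for w w'
  proof -
    have "lorentz_form n w w' \<le> sqrt (lorentz_form n w w * lorentz_form n w' w')"
      using pair[OF that] by (intro real_le_rsqrt) simp
    also have "\<dots> = sqrt (- lorentz_form n w w) * sqrt (- lorentz_form n w' w')"
      by (simp add: real_sqrt_mult[symmetric])
    finally have "c w w' \<le> (sqrt (- lorentz_form n w w) * sqrt (- lorentz_form n w' w'))
        / (lorentz_form n w p * lorentz_form n w' p)"
      unfolding c_def using pos[OF that(1)] pos[OF that(2)] by (intro divide_right_mono) auto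
    then show "c w w' \<le> r w * r w'"
      by (simp add: r_def)
    show "0 \<le> c w w'"
      using pair[OF that] pos[OF that(1)] pos[OF that(2)] by (simp add: c_def)
  qed
  have zz: "lorentz_form n (z w) (z w') = c w w' - c w w0 - c w' w0 + c w0 w0" for w w'
    using lorentz_form_commute[of n w0 w']
    by (simp add: z_def lorentz_form_lcomb c_def algebra_simps)
  have zp: "lorentz_form n (z w) p = 0" if "w \<in> F" for w
    using pos[OF that] pos[OF w0(1)] by (simp add: z_def lorentz_form_lcomb)
  obtain T where T: "\<And>x. T x \<in> topspace (Euclidean_space d)"
    "\<And>x y. lorentz_form n x p = 0 \<Longrightarrow> lorentz_form n y p = 0 \<Longrightarrow>
        eucl_inner d (T x) (T y) = - lorentz_form n x y"
    using null_complement_projection[of d p] p unfolding nd by blast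
  define N where "N w = sqrt (eucl_inner d (T (z w)) (T (z w)))" for w
  define y where "y w = (\<lambda>i. 1 / N w * T (z w) i)" for w
  let ?G = "F - {w0}"
  have norm: "N w = sqrt ((r w)\<^sup>2 + (r w0)\<^sup>2 + 2 * c w w0)" "N w > 0" if "w \<in> ?G" for w
  proof -
    show eq: "N w = sqrt ((r w)\<^sup>2 + (r w0)\<^sup>2 + 2 * c w w0)"
      using that w0(1) by (simp add: N_def T(2) zp zz cself)
    show "N w > 0"
      unfolding eq using that w0(1) c(1)[of w w0] rpos[of w] by (simp add: add_pos_nonneg)
  qed
  have unit: "eucl_inner d (y w) (y w) = 1" if "w \<in> ?G" for w
  proof -
    have "eucl_inner d (T (z w)) (T (z w)) = N w * N w"
      by (simp add: N_def eucl_inner_nonneg)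
    then show ?thesis
      unfolding y_def eucl_inner_scale using norm(2)[OF that] by simp
  qed
  have close: "eucl_inner d (y w) (y w') \<le> 3/4" if "w \<in> ?G" "w' \<in> ?G" "w \<noteq> w'" for w w'
  proof -
    have "eucl_inner d (T (z w)) (T (z w')) = (r w0)\<^sup>2 + c w w0 + c w' w0 - c w w'"
      using that w0(1) by (simp add: T(2) zp zz cself)
    also have "\<dots> \<le> (r w0)\<^sup>2 + c w w0 + c w' w0"
      using c(1)[of w w'] that by simp
    also have "\<dots> \<le> 3/4 * (N w * N w')"
      unfolding norm(1)[OF that(1)] norm(1)[OF that(2)]
      using that c w0 rpos by (intro kissing_cosine_bound) auto
    finally show ?thesis
      unfolding y_def eucl_inner_scale using norm(2) that by (simp add: field_simps)
  qed
  have inj: "inj_on y ?G"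
  proof (rule inj_onI, rule ccontr)
    fix w w' assume "w \<in> ?G" "w' \<in> ?G" "y w = y w'" "w \<noteq> w'"
    then show False
      using close[of w w'] unit[of w] by simp
  qed
  have "y w \<in> unit_sphere d" if "w \<in> ?G" for w
    using unit[OF that] T(1)[of "z w"] by (simp add: unit_sphere_def topspace_Euclidean_space y_def)
  moreover have "sph_angle d (y w) (y w') \<ge> arccos (3/4)" if "w \<in> ?G" "w' \<in> ?G" "w \<noteq> w'" for w w'
    unfolding sph_angle_def using close[OF that] eucl_inner_unit_bound[of d "y w" "y w'"] unit that
    by (intro arccos_le_arccos) (auto simp: abs_le_iff)
  ultimately have "spherical_code d (arccos (3/4)) (y ` ?G)"
    unfolding spherical_code_def by blast
  then have "card (y ` ?G) \<le> spherical_kissing d (arccos (3/4))"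
    using arccos_three_quarters by (intro spherical_kissing_upper) auto
  then show ?thesis
    using w0(1) fin by (simp add: card_image[OF inj] d_def card_Diff_singleton)
qed simp

text \<open>
  The two exceptional members are \<open>w\<close>, the half-space around the point placed at infinity, and
  the smallest of the remaining balls.
\<close>

lemma strict_hyp_kissing_upper:
  assumes "n \<ge> 1"
  shows "strict_hyp_kissing n (pi / 2) \<le> enat (spherical_kissing (n - 1) (arccos (3/4)) + 2)"
proof (rule strict_hyp_kissing_leI)
  fix S F :: "((nat \<Rightarrow> real) \<times> real) set"
  assume S: "strict_code n S" "ereal (pi / 2) \<le> code_angle n S" and F: "finite F" "F \<subseteq> S"
  obtain q where q: "q \<in> hyperboloid n" "\<And>w. w \<in> S \<Longrightarrow> lorentz_form n w q > 0"
    using strict_code_witness[OF S(1)] by blast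
  have neg: "w \<in> negative_vectors n" if "w \<in> S" for w
    using S(1) that by (auto simp: strict_code_def hyperbolic_code_def)
  have pair: "lorentz_form n w w' \<ge> 0 \<and>
       (lorentz_form n w w')\<^sup>2 \<le> lorentz_form n w w * lorentz_form n w' w'"
    if "w \<in> S" "w' \<in> S" "w \<noteq> w'" for w w'
    using right_angle_condition[OF neg[OF that(1)] neg[OF that(2)]]
      code_angle_le_hyp_angle[OF that, of n] S(2) by (metis order_trans)
  show "card F \<le> spherical_kissing (n - 1) (arccos (3/4)) + 2"
  proof (cases "F = {}")
    case False
    then obtain w where w: "w \<in> F" by blast
    have wq: "lorentz_form n w w < 0" "lorentz_form n w q > 0" "lorentz_form n q q = 1"
      using neg[of w] q(2)[of w] q(1) w F(2) by (auto simp: negative_vectors_def hyperboloid_def)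
    obtain p where p: "lorentz_form n p p = 0"
      "\<And>w'. lorentz_form n w' q > 0 \<Longrightarrow> lorentz_form n w w' \<ge> 0 \<Longrightarrow> lorentz_form n w' p > 0"
      using ideal_point_of_cap[OF wq] by metis
    have "card (F - {w}) \<le> spherical_kissing (n - 1) (arccos (3/4)) + 1"
    proof (cases "F = {w}")
      case False
      then obtain v where v: "v \<in> F" "v \<noteq> w"
        using w by blast
      then have vp: "lorentz_form n v p > 0"
        using p(2) q(2) pair w F by blast
      have sp: "snd p \<noteq> 0"
      proof
        assume "snd p = 0"
        moreover from this have "eucl_inner n (fst p) (fst p) = 0"
          using p(1) by (simp add: lorentz_form_def)
        moreover have "(eucl_inner n (fst v) (fst p))\<^sup>2 \<le> eucl_inner n (fst v) (fst v) * eucl_inner n (fst p) (fst p)"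
          by (rule eucl_inner_Cauchy_Schwarz)
        ultimately show False
          using vp by (simp add: lorentz_form_def)
      qed
      show ?thesis
      proof (rule obtuse_balls_card_le[OF _ p(1) sp assms])
        show "finite (F - {w})"
          using F(1) by simp
        show "lorentz_form n w' w' < 0" if "w' \<in> F - {w}" for w'
          using neg[of w'] that F(2) by (auto simp: negative_vectors_def)
        show "lorentz_form n w' p > 0" if "w' \<in> F - {w}" for w'
          using p(2)[of w'] q(2)[of w'] pair[of w w'] that w F(2) by blast
        show "lorentz_form n w1 w2 \<ge> 0 \<and>
            (lorentz_form n w1 w2)\<^sup>2 \<le> lorentz_form n w1 w1 * lorentz_form n w2 w2"
          if "w1 \<in> F - {w}" "w2 \<in> F - {w}" "w1 \<noteq> w2" for w1 w2
          using pair[of w1 w2] that F(2) by blast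
      qed
    qed simp
    then show ?thesis
      using w F by (simp add: card_Diff_singleton)
  qed simp
qed

theorem theorem1p5:
  shows "strict_hyp_kissing 0 (pi/2) = 0 \<and>
         strict_hyp_kissing 1 (pi/2) = 1 \<and>
         (\<forall>n\<ge>2.
            enat (spherical_kissing (n - 1) (2 * arccos (3/4)) div 2)
              \<le> strict_hyp_kissing n (pi/2) \<and>
            strict_hyp_kissing n (pi/2)
              \<le> enat (spherical_kissing (n - 1) (arccos (3/4)) + 2))"
  using strict_hyp_kissing_0 strict_hyp_kissing_1 strict_hyp_kissing_lower strict_hyp_kissing_upper
  by simp

end
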